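(* There exist a constant $C_1(\ell)>0$ for each integer $\ell\ge 1$ (depending only on $\ell$), and an absolute constant $C_3>0$, such that, with $C_2:=32\pi e$, the following holds. Let $\ell\ge 1$ be an integer, let $\mathcal{X}=\{x_1,\dots,x_\ell\}\subset(-\pi,\pi]$ form a $(\Delta,\ell,\tau)_{\mathbb{T}}$-clustered configuration, and denote the singular values of $\mathbf{V}_N(\mathcal{X})$ by $\sigma_1\ge\sigma_2\ge\dots\ge\sigma_\ell$. Then for any integer $N$ satisfying $C_1(\ell)\le N\le\frac{2\pi}{\tau\Delta}$, $$\sigma_m\bigl(\mathbf{V}_N(\mathcal{X})\bigr)\ \ge\ C_3\,\sqrt{N}\,\Bigl(\frac{N\Delta}{C_2}\Bigr)^{m-1},\qquad m=1,2,\dots,\ell.$$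
   Context: For a finite set of $s$ distinct nodes $\mathcal{X}=\{x_1,\dots,x_s\}\subset(-\pi,\pi]$ and an integer $N\ge s-1$, $\mathbf{V}_N(\mathcal{X})$ is the $(N+1)\times s$ Vandermonde matrix $\mathbf{V}_N(\mathcal{X})=\bigl[e^{\imath k x_j}\bigr]_{0\le k\le N}^{1\le j\le s}$ (rows indexed by $k$, columns by $j$). Wrap-around distance: for $x,y\in\mathbb{R}$, $d(x,y):=\bigl|\operatorname{Arg}\exp(\imath(x-y))\bigr|\in[0,\pi]$, where $\operatorname{Arg}$ is the principal argument with values in $(-\pi,\pi]$. A set $\mathcal{X}=\{x_1,\dots,x_\ell\}\subset(-\pi,\pi]$ of $\ell$ distinct nodes forms a $(\Delta,\ell,\tau)_{\mathbb{T}}$-cluster (equivalently, a $(\Delta,\ell,\tau)_{\mathbb{T}}$-clustered configuration), where $\Delta>0$ and $\ell-1\le\tau\le\frac{\pi}{\Delta}$, if $\Delta\le d(x,y)\le\tau\Delta$ for all $x,y\in\mathcal{X}$ with $x\ne y$. If $\tau=0$ (possible only for $\ell=1$), the bound $N\le\frac{2\pi}{\tau\Delta}$ is read as no upper restriction on $N$. *)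

theory Defs
  imports
    Complex_Main
    "Jordan_Normal_Form.Char_Poly"
    "Jordan_Normal_Form.Schur_Decomposition"
begin

(* The nodes are given as a list, which fixes the order of the columns;
   columns are indexed from 0, so column j belongs to the node x_(j+1). *)
definition vandermonde :: "nat \<Rightarrow> real list \<Rightarrow> complex mat" where
  "vandermonde N xs =
     mat (N + 1) (length xs) (\<lambda>(k, j). exp (\<i> * of_nat k * of_real (xs ! j)))"

(* Square roots of the eigenvalues of the Gram matrix A^H A, repeated according to algebraic
   multiplicity, in decreasing order. The eigenvalues of A^H A are real and nonnegative, so
   taking Re loses nothing. The list has dim_col A entries, which is the usual number
   min (dim_row A) (dim_col A) of singular values whenever dim_col A <= dim_row A. *)
definition singular_values :: "complex mat \<Rightarrow> real list" where
  "singular_values A =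
     rev (sorted_list_of_multiset
       (image_mset (\<lambda>z. sqrt (Re z)) (proots (char_poly (mat_adjoint A * A)))))"

(* Singular values are numbered from 1: m = 1 is the largest one. *)
definition singular_value :: "nat \<Rightarrow> complex mat \<Rightarrow> real" where
  "singular_value m A = singular_values A ! (m - 1)"

definition wrap_dist :: "real \<Rightarrow> real \<Rightarrow> real" where
  "wrap_dist x y = \<bar>Arg (exp (\<i> * of_real (x - y)))\<bar>"

definition clustered :: "real \<Rightarrow> nat \<Rightarrow> real \<Rightarrow> real set \<Rightarrow> bool" where
  "clustered \<Delta> l \<tau> X \<longleftrightarrow>
     finite X \<and> card X = l \<and> X \<subseteq> {-pi<..pi} \<and>
     \<Delta> > 0 \<and> real l - 1 \<le> \<tau> \<and> \<tau> \<le> pi / \<Delta> \<and>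
     (\<forall>x\<in>X. \<forall>y\<in>X. x \<noteq> y \<longrightarrow> \<Delta> \<le> wrap_dist x y \<and> wrap_dist x y \<le> \<tau> * \<Delta>)"

end

theory Submission
  imports Defs "Jordan_Normal_Form.Jordan_Normal_Form_Existence"
begin

text \<open>
  Let $n = m - 1$. By the Courant--Fischer principle the $m$-th singular value of the Vandermonde matrix
  with all $\ell$ nodes is at least the smallest one of the matrix with any $m$ of the nodes
  (\<open>singular_value_ge\<close>). So everything reduces to a lower bound for the energy $\sum_{k \le N} |f(k)|^2$ of
  an exponential sum $f(k) = \sum_{j \le n} c_j z_j^k$ in terms of its coefficients, where the $m$ nodes
  are $\Delta$-separated and have mutual distance at most $2\pi/N$ (\<open>vandermonde_lower_bound\<close>).

  To isolate $c_j$, apply the difference operators $f \mapsto f(\cdot + K) - z_i^K f$ for all $i \ne j$, with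
  step $K$ about $N/(2n)$. Each one increases the energy at most fourfold and shortens the window by $K$, so
  half of the window remains, and on it one sees $c_j z_j^k \prod_{i \ne j} (z_j^K - z_i^K)$
  (\<open>exponential_sum_energy_ge\<close>). The distance bound keeps $K$ times each angle below $\pi$, so that the
  product is at least $\prod_i K |\theta_i| / \pi$, where $\theta_i$ is the angle from the $j$-th to the
  $i$-th node. These angles are $\Delta$-separated real numbers, also from 0, so the product of their
  absolute values is at least $(\Delta/2)^n n!$ (\<open>separated_prod_ge\<close>). With $n! \ge (n/e)^n$ the factor
  $n^n$ from the step cancels, and the bound is of the form $(N \Delta / C)^n \sqrt{N}$ with $C$ independent
  of $\ell$. The constant $32\pi e$ leaves enough room for the rounding of $K$, for a crude estimate of the
  sine, and for the factor $\sqrt{m}$ lost when passing from each coefficient to all of them.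

  The threshold $C_1(\ell) = 2\ell$ makes $K \ge 1$, so that rounding costs at most a factor 2 in $K$; the
  constant $C_3$ is $1/2$.
\<close>

section \<open>Angles and products of separated numbers\<close>

text \<open>
  The principal argument is the representative of least absolute value. With this, separation on the
  circle turns into separation of real numbers, without the nodes having to be moved to a common arc.
\<close>
lemma wrap_dist_le_abs_representative:
  assumes "exp (\<i> * of_real t) = exp (\<i> * of_real (x - y))"
  shows "wrap_dist x y \<le> \<bar>t\<bar>"
proof (cases "\<bar>t\<bar> < pi")
  case True
  have "Arg (exp (\<i> * of_real (x - y))) = t"
    by (rule cis_Arg_unique) (use True assms in \<open>auto simp: cis_conv_exp sgn_eq simp flip: assms\<close>)
  then show ?thesis by (simp add: wrap_dist_def)
next
  case False
  then show ?thesis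
    using Arg_bounded[of "exp (\<i> * of_real (x - y))"] unfolding wrap_dist_def by linarith
qed

text \<open>
  The cubic Taylor remainder gives $|\sin x - x| \le |x|^3/6 \le 2|x|/3$. On a quarter period the sharp slope
  is \<^term>\<open>2/pi\<close>, but the constant \<^term>\<open>32 * pi * exp 1\<close> has room for the loss.
\<close>
lemma abs_sin_ge_third:
  fixes x :: real
  assumes "\<bar>x\<bar> \<le> 2"
  shows "\<bar>x\<bar> / 3 \<le> \<bar>sin x\<bar>"
proof -
  have "\<bar>sin x - (\<Sum>m<3. sin_coeff m * x ^ m)\<bar> \<le> inverse (fact 3) * \<bar>x\<bar> ^ 3"
    by (rule Maclaurin_sin_bound)
  then have "\<bar>sin x - x\<bar> \<le> \<bar>x\<bar> ^ 3 / 6"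
    by (simp add: sin_coeff_def eval_nat_numeral field_simps)
  moreover have "\<bar>x\<bar> ^ 3 \<le> 4 * \<bar>x\<bar>"
    using assms mult_right_mono[of "x\<^sup>2" 4 "\<bar>x\<bar>"] abs_le_square_iff[of x 2]
    by (simp add: power3_eq_cube power2_eq_square)
  ultimately show ?thesis by linarith
qed

lemma norm_diff_exp_ge:
  fixes t :: real
  assumes "\<bar>t\<bar> \<le> pi"
  shows "\<bar>t\<bar> / pi \<le> norm (1 - exp (\<i> * of_real t))"
proof -
  have "norm (1 - exp (\<i> * of_real t)) ^ 2 = (2 * \<bar>sin (t / 2)\<bar>) ^ 2"
  proof -
    have "norm (1 - cis t) ^ 2 = (1 - cos t)\<^sup>2 + (sin t)\<^sup>2"
      by (simp add: cmod_power2)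
    also have "\<dots> = 2 - 2 * cos t"
      using sin_cos_squared_add[of t] by (simp add: power2_eq_square algebra_simps)
    also have "\<dots> = 4 * (sin (t / 2))\<^sup>2"
      using cos_double_sin[of "t / 2"] by simp
    finally show ?thesis by (simp add: cis_conv_exp power_mult_distrib)
  qed
  then have "norm (1 - exp (\<i> * of_real t)) = 2 * \<bar>sin (t / 2)\<bar>"
    by (subst (asm) power2_eq_iff_nonneg) auto
  moreover have "\<bar>t / 2\<bar> / 3 \<le> \<bar>sin (t / 2)\<bar>"
    by (rule abs_sin_ge_third) (use assms pi_less_4 in auto)
  moreover have "\<bar>t\<bar> / pi \<le> \<bar>t\<bar> / 3"
  proof -
    have "3 \<le> pi" using sin_x_le_x[of "pi / 6"] by (simp add: sin_30)
    then show ?thesis by (intro divide_left_mono) auto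
  qed
  ultimately show ?thesis by linarith
qed

text \<open>
  In increasing order the $k$-th element is at least $k d$, because the smallest is at least $d$ and
  consecutive ones differ by at least $d$.
\<close>
lemma separated_positive_prod_ge:
  fixes S :: "real set"
  assumes "finite S" "d > 0" "\<And>x. x \<in> S \<Longrightarrow> d \<le> x"
    and "\<And>x y. x \<in> S \<Longrightarrow> y \<in> S \<Longrightarrow> x \<noteq> y \<Longrightarrow> d \<le> \<bar>x - y\<bar>"
  shows "d ^ card S * fact (card S) \<le> \<Prod>S"
proof -
  \<comment> \<open>The second conjunct is the bound for the next, larger element, so that
    one induction along increasing elements gives both.\<close>
  have "d ^ card S * fact (card S) \<le> \<Prod>S \<and>
    (\<forall>b. d \<le> b \<longrightarrow> (\<forall>s\<in>S. s + d \<le> b) \<longrightarrow> (real (card S) + 1) * d \<le> b)"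
    using assms(1,3,4)
  proof (induction rule: finite_linorder_max_induct)
    case empty
    then show ?case by simp
  next
    case (insert b A)
    have notin: "b \<notin> A" using insert.hyps by auto
    have IH: "d ^ card A * fact (card A) \<le> \<Prod>A"
      "\<And>b. d \<le> b \<Longrightarrow> (\<forall>s\<in>A. s + d \<le> b) \<Longrightarrow> (real (card A) + 1) * d \<le> b"
      using insert.IH insert.prems by auto
    have "\<forall>s\<in>A. s + d \<le> b"
    proof
      fix s assume "s \<in> A"
      then have "s < b" "d \<le> \<bar>s - b\<bar>" using insert.hyps insert.prems(2)[of s b] by auto
      then show "s + d \<le> b" by linarith
    qed
    then have b: "(real (card A) + 1) * d \<le> b"
      using IH(2)[of b] insert.prems(1) by auto
    have "(d ^ card A * fact (card A)) * ((real (card A) + 1) * d) \<le> \<Prod>A * b"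
      using IH(1) b \<open>d > 0\<close> insert.prems(1)
      by (intro mult_mono) (auto intro!: prod_nonneg simp: less_imp_le order_trans[of 0 d])
    then have "d ^ card (insert b A) * fact (card (insert b A)) \<le> \<Prod>(insert b A)"
      using notin insert.hyps by (simp add: algebra_simps)
    moreover have "(real (card (insert b A)) + 1) * d \<le> b'" if "\<forall>s\<in>insert b A. s + d \<le> b'" for b'
      using that b notin insert.hyps by (simp add: algebra_simps)
    ultimately show ?case by blast
  qed
  then show ?thesis by blast
qed

text \<open>
  A binomial coefficient is at most $2^{a+b}$.
\<close>
lemma fact_mult_fact_ge: "fact (a + b) / 2 ^ (a + b) \<le> (fact a * fact b :: real)"
proof -
  have "(fact (a + b) :: nat) = fact a * fact b * ((a + b) choose a)"
    using binomial_fact_lemma[of a "a + b"] by simp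
  also have "\<dots> \<le> fact a * fact b * 2 ^ (a + b)"
    by (intro mult_left_mono binomial_le_pow2) auto
  finally have "real (fact (a + b)) \<le> real (fact a * fact b * 2 ^ (a + b))"
    by (simp only: of_nat_le_iff)
  then show ?thesis by (simp add: field_simps)
qed

text \<open>
  Split by sign: the $a$ positive and the $b$ negative elements contribute $a!$ and $b!$, and the loss
  against $(a+b)!$ is only $2^{a+b}$. This is the source of the factorial that later cancels the power
  of the number of nodes, and hence the reason that the base in the final bound does not depend on it.
\<close>
lemma separated_prod_ge:
  fixes T :: "real set"
  assumes "finite T" "d > 0" "\<And>x. x \<in> T \<Longrightarrow> d \<le> \<bar>x\<bar>"
    and sep: "\<And>x y. x \<in> T \<Longrightarrow> y \<in> T \<Longrightarrow> x \<noteq> y \<Longrightarrow> d \<le> \<bar>x - y\<bar>"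
  shows "(d / 2) ^ card T * fact (card T) \<le> (\<Prod>t\<in>T. \<bar>t\<bar>)"
proof -
  define P where "P = {t\<in>T. t > 0}"
  define Q where "Q = {t\<in>T. t < 0}"
  have T: "T = P \<union> Q" using assms(2,3) by (force simp: P_def Q_def)
  have fin: "finite P" "finite Q" "P \<inter> Q = {}" using assms(1) by (auto simp: P_def Q_def)
  have inj: "inj_on uminus Q" by (simp add: inj_on_def)
  have p: "d ^ card P * fact (card P) \<le> \<Prod>P"
    by (rule separated_positive_prod_ge) (use assms fin in \<open>force simp: P_def\<close>)+
  have "d ^ card (uminus ` Q) * fact (card (uminus ` Q)) \<le> \<Prod>(uminus ` Q)"
  proof (rule separated_positive_prod_ge)
    fix x y assume "x \<in> uminus ` Q" "y \<in> uminus ` Q" "x \<noteq> y"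
    then show "d \<le> \<bar>x - y\<bar>" using sep[of "-x" "-y"] by (auto simp: Q_def)
  qed (use assms fin in \<open>force simp: Q_def\<close>)+
  then have q: "d ^ card Q * fact (card Q) \<le> (\<Prod>t\<in>Q. \<bar>t\<bar>)"
    using inj by (simp add: card_image prod.reindex)
      (subst prod.cong[where h = uminus], auto simp: Q_def)
  have card: "card T = card P + card Q" unfolding T using fin by (simp add: card_Un_disjoint)
  have "(d / 2) ^ card T * fact (card T) = d ^ card T * (fact (card T) / 2 ^ card T)"
    by (simp add: power_divide)
  also have "\<dots> \<le> d ^ card T * (fact (card P) * fact (card Q))"
    unfolding card by (intro mult_left_mono fact_mult_fact_ge) (use assms in auto)
  also have "\<dots> = (d ^ card P * fact (card P)) * (d ^ card Q * fact (card Q))"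
    by (simp add: card power_add)
  also have "\<dots> \<le> \<Prod>P * (\<Prod>t\<in>Q. \<bar>t\<bar>)"
    using p q \<open>d > 0\<close> by (intro mult_mono) (auto intro!: prod_nonneg simp: P_def)
  also have "\<Prod>P = (\<Prod>t\<in>P. \<bar>t\<bar>)" by (intro prod.cong) (auto simp: P_def)
  also have "(\<Prod>t\<in>P. \<bar>t\<bar>) * (\<Prod>t\<in>Q. \<bar>t\<bar>) = (\<Prod>t\<in>T. \<bar>t\<bar>)"
    unfolding T using fin by (simp add: prod.union_disjoint)
  finally show ?thesis .
qed

text \<open>
  One term of the exponential series is at most its sum.
\<close>
lemma fact_ge_power_div_exp: "(real n / exp 1) ^ n \<le> fact n"
proof -
  have s: "(\<lambda>k. real n ^ k /\<^sub>R fact k) sums exp (real n)" by (rule exp_converges)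
  then have "(\<Sum>k\<in>{n}. real n ^ k /\<^sub>R fact k) \<le> exp (real n)"
    by (subst sums_unique[OF s]) (intro sum_le_suminf, auto simp: sums_iff)
  then show ?thesis
    by (simp add: field_simps power_divide exp_of_nat_mult[of n 1, simplified])
qed

section \<open>Lower bounds for exponential sums\<close>

text \<open>
  The operator that sends $f$ to $k \mapsto f(k+K) - w f(k)$ multiplies the exponential $k \mapsto z^k$ by
  $z^K - w$, and for $|w| = 1$ it increases the energy by a factor of at most 4, at the cost of a window
  that is longer by $K$. Applying it once with $w = z_i^K$ for every \<^term>\<open>i \<in> I\<close> gives the lemma; the
  exponentials with an index in both sets are annihilated.
\<close>
lemma exponential_sum_energy_ge:
  fixes z c :: "'a \<Rightarrow> complex" and K :: nat
  assumes "finite I" and z: "\<And>i. i \<in> I \<Longrightarrow> norm (z i) = 1"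
  shows "(\<Sum>k\<le>M. (norm (\<Sum>j\<in>J. c j * (\<Prod>i\<in>I. z j ^ K - z i ^ K) * z j ^ k))\<^sup>2)
    \<le> 4 ^ card I * (\<Sum>k\<le>M + K * card I. (norm (\<Sum>j\<in>J. c j * z j ^ k))\<^sup>2)"
  using assms
proof (induction I arbitrary: M rule: finite_induct)
  case empty
  then show ?case by simp
next
  case (insert i I)
  define g where "g k = (\<Sum>j\<in>J. c j * (\<Prod>i\<in>I. z j ^ K - z i ^ K) * z j ^ k)" for k
  have step: "(\<Sum>j\<in>J. c j * (\<Prod>i\<in>insert i I. z j ^ K - z i ^ K) * z j ^ k) = g (k + K) - z i ^ K * g k" for k
    using insert.hyps unfolding g_def sum_distrib_left sum_subtractf[symmetric]
    by (intro sum.cong) (auto simp: algebra_simps power_add)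
  have bd: "(norm (g (k + K) - z i ^ K * g k))\<^sup>2 \<le> 2 * (norm (g (k + K)))\<^sup>2 + 2 * (norm (g k))\<^sup>2" for k
  proof -
    have "norm (g (k + K) - z i ^ K * g k) \<le> norm (g (k + K)) + norm (g k)"
      using norm_triangle_ineq4[of "g (k + K)" "z i ^ K * g k"] insert.prems[of i]
      by (simp add: norm_mult norm_power)
    then have "(norm (g (k + K) - z i ^ K * g k))\<^sup>2 \<le> (norm (g (k + K)) + norm (g k))\<^sup>2"
      by (intro power_mono) auto
    also have "\<dots> \<le> 2 * (norm (g (k + K)))\<^sup>2 + 2 * (norm (g k))\<^sup>2"
      using zero_le_power2[of "norm (g (k + K)) - norm (g k)"]
      by (simp add: power2_eq_square algebra_simps)
    finally show ?thesis .
  qed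
  have shift: "(\<Sum>k\<le>M. (norm (g (k + K)))\<^sup>2) \<le> (\<Sum>k\<le>M + K. (norm (g k))\<^sup>2)"
  proof -
    have "(\<Sum>k\<le>M. (norm (g (k + K)))\<^sup>2) = (\<Sum>k\<in>(\<lambda>k. k + K) ` {..M}. (norm (g k))\<^sup>2)"
      by (subst sum.reindex) auto
    also have "\<dots> \<le> (\<Sum>k\<le>M + K. (norm (g k))\<^sup>2)"
      by (intro sum_mono2) auto
    finally show ?thesis .
  qed
  have mono: "(\<Sum>k\<le>M. (norm (g k))\<^sup>2) \<le> (\<Sum>k\<le>M + K. (norm (g k))\<^sup>2)"
    by (intro sum_mono2) auto
  have "(\<Sum>k\<le>M. (norm (g (k + K) - z i ^ K * g k))\<^sup>2)
      \<le> 2 * (\<Sum>k\<le>M. (norm (g (k + K)))\<^sup>2) + 2 * (\<Sum>k\<le>M. (norm (g k))\<^sup>2)"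
    unfolding sum_distrib_left sum.distrib[symmetric] by (intro sum_mono bd)
  also have "\<dots> \<le> 4 * (\<Sum>k\<le>M + K. (norm (g k))\<^sup>2)" using shift mono by linarith
  also have "\<dots> \<le> 4 * (4 ^ card I * (\<Sum>k\<le>(M + K) + K * card I. (norm (\<Sum>j\<in>J. c j * z j ^ k))\<^sup>2))"
    unfolding g_def by (intro mult_left_mono insert.IH) (use insert.prems in auto)
  finally show ?case unfolding step using insert.hyps by (simp add: algebra_simps)
qed

text \<open>
  Annihilate all nodes but one, $x_j$. This leaves $c_j z_j^k \prod_i (z_j^K - z_i^K)$, whose energy over
  the remaining window of about $N/2$ places is explicit, so the coefficient $c_j$ is bounded by the
  energy of the whole sum. The step $K \approx N/(2n)$ is as large as it can be while $n$ steps consume at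
  most half of the window; the diameter hypothesis ensures that the angles $K (x_i - x_j)$ still do not
  wrap around, so each factor is at least $K |\theta_i| / \pi$ with $\theta_i$ the signed angle from $x_j$
  to $x_i$. The product of the $|\theta_i|$ is at least $(d/2)^n n!$ by separation, and $n! \ge (n/e)^n$
  cancels the $n$ in $K$. Averaging over $j$ loses a factor $n+1$, which is absorbed by $4^n$.
\<close>
lemma vandermonde_lower_bound:
  fixes x :: "nat \<Rightarrow> real" and c :: "nat \<Rightarrow> complex"
  assumes d: "d > 0" and N: "2 * (n + 1) \<le> N"
    and sep: "\<And>i j. i \<le> n \<Longrightarrow> j \<le> n \<Longrightarrow> i \<noteq> j \<Longrightarrow> d \<le> wrap_dist (x i) (x j)"
    and diam: "\<And>i j. i \<le> n \<Longrightarrow> j \<le> n \<Longrightarrow> i \<noteq> j \<Longrightarrow> real N * wrap_dist (x i) (x j) \<le> 2 * pi"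
  shows "((1/2) * sqrt (real N) * (real N * d / (32 * pi * exp 1)) ^ n)\<^sup>2 * (\<Sum>j\<le>n. (norm (c j))\<^sup>2)
    \<le> (\<Sum>k\<le>N. (norm (\<Sum>j\<le>n. c j * exp (\<i> * of_real (x j)) ^ k))\<^sup>2)"
proof -
  \<comment> \<open>A single node needs no annihilation; the value 0 of the quotient by 0 is then harmless.\<close>
  define K where "K = N div (2 * n)"
  define z where "z j = exp (\<i> * of_real (x j))" for j
  \<comment> \<open>The product over the other nodes turns out to be at least \<^term>\<open>(4 * q) ^ n\<close>. Of the $16^n$ in its square,
    one $4^n$ pays for the energy growth and the other for the average over the nodes.\<close>
  define q where "q = real N * d / (32 * pi * exp 1)"
  define F where "F = (\<Sum>k\<le>N. (norm (\<Sum>j\<le>n. c j * z j ^ k))\<^sup>2)"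
  have q0: "0 \<le> q" using d by (simp add: q_def)
  have z1: "norm (z j) = 1" for j by (simp add: z_def flip: cis_conv_exp)
  have Kn: "2 * (K * n) \<le> N"
    using div_times_less_eq_dividend[of N "2 * n"] by (simp add: K_def algebra_simps)
  have K4: "real N \<le> 4 * real n * real K" if "n \<ge> 1"
  proof -
    have "K \<ge> 1" unfolding K_def using that N by (simp add: div_greater_zero_iff Suc_le_eq)
    have "N < 2 * n * (K + 1)"
      unfolding K_def using that by (metis dividend_less_times_div mult.commute mult_pos_pos
        Suc_eq_plus1 mult_Suc_right add.commute zero_less_numeral less_eq_Suc_le One_nat_def)
    also have "\<dots> \<le> 2 * n * (2 * K)" using \<open>K \<ge> 1\<close> by (intro mult_left_mono) auto
    finally have "real N \<le> real (2 * n * (2 * K))" by (simp only: of_nat_le_iff less_imp_le)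
    then show ?thesis by (simp add: algebra_simps)
  qed
  have const: "(4 * q) ^ n \<le> (real K / pi) ^ n * ((d / 2) ^ n * fact n)"
  proof (cases "n = 0")
    case False
    have "4 * q = (real N / (4 * real n)) / pi * (d / 2) * (real n / exp 1)"
      using False by (simp add: q_def field_simps)
    also have "\<dots> \<le> real K / pi * (d / 2) * (real n / exp 1)"
      using K4 False d by (intro mult_right_mono divide_right_mono) (auto simp: field_simps)
    finally have "(4 * q) ^ n \<le> (real K / pi * (d / 2) * (real n / exp 1)) ^ n"
      using q0 by (intro power_mono) auto
    also have "\<dots> = (real K / pi) ^ n * ((d / 2) ^ n * (real n / exp 1) ^ n)"
      by (simp only: power_mult_distrib mult.assoc)
    also have "\<dots> \<le> (real K / pi) ^ n * ((d / 2) ^ n * fact n)"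
      using d by (intro mult_left_mono fact_ge_power_div_exp) auto
    finally show ?thesis .
  qed auto
  have node: "(real N / 2) * (4 * q\<^sup>2) ^ n * (norm (c j))\<^sup>2 \<le> F" if j: "j \<le> n" for j
  proof -
    define I where "I = {..n} - {j}"
    define \<theta> where "\<theta> i = Arg (exp (\<i> * of_real (x i - x j)))" for i
    have I: "finite I" "card I = n" using j by (auto simp: I_def)
    have e\<theta>: "exp (\<i> * of_real (\<theta> i)) = exp (\<i> * of_real (x i - x j))" for i
      using cis_Arg[of "exp (\<i> * of_real (x i - x j))"]
      by (simp add: \<theta>_def sgn_eq flip: cis_conv_exp)
    have \<theta>sep: "d \<le> \<bar>\<theta> i - \<theta> i'\<bar>" if "i \<in> I" "i' \<in> I" "i \<noteq> i'" for i i'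
    proof -
      have "wrap_dist (x i) (x i') \<le> \<bar>\<theta> i - \<theta> i'\<bar>"
        by (rule wrap_dist_le_abs_representative)
           (simp add: right_diff_distrib exp_diff e\<theta>[unfolded of_real_diff right_diff_distrib exp_diff])
      then show ?thesis using sep[of i i'] that by (auto simp: I_def)
    qed
    have \<theta>w: "\<bar>\<theta> i\<bar> = wrap_dist (x i) (x j)" for i by (simp add: wrap_dist_def \<theta>_def)
    have \<theta>ge: "d \<le> \<bar>\<theta> i\<bar>" if "i \<in> I" for i
      using sep[of i j] that j by (simp add: \<theta>w I_def)
    have inj: "inj_on \<theta> I" using \<theta>sep d by (force simp: inj_on_def)
    have factor: "real K * \<bar>\<theta> i\<bar> / pi \<le> norm (z j ^ K - z i ^ K)" if i: "i \<in> I" for i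
    proof -
      have "n \<ge> 1" using i j by (auto simp: I_def)
      then have "2 * K \<le> 2 * (K * n)" by simp
      then have "2 * real K \<le> real N" using Kn by linarith
      then have "2 * real K * \<bar>\<theta> i\<bar> \<le> real N * \<bar>\<theta> i\<bar>" by (intro mult_right_mono) auto
      also have "\<dots> \<le> 2 * pi" using diam[of i j] i j by (simp add: \<theta>w I_def)
      finally have "\<bar>real K * \<theta> i\<bar> \<le> pi" by (simp add: abs_mult)
      then have "\<bar>real K * \<theta> i\<bar> / pi \<le> norm (1 - exp (\<i> * of_real (real K * \<theta> i)))"
        by (rule norm_diff_exp_ge)
      also have "exp (\<i> * of_real (real K * \<theta> i)) = exp (\<i> * of_real (\<theta> i)) ^ K"
        by (simp add: exp_of_nat_mult[symmetric] algebra_simps)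
      also have "exp (\<i> * of_real (\<theta> i)) = z i / z j"
        unfolding e\<theta> z_def by (simp add: right_diff_distrib exp_diff)
      also have "norm (1 - (z i / z j) ^ K) = norm (z j ^ K - z i ^ K)"
      proof -
        have "z j \<noteq> 0" using z1[of j] by auto
        then have "1 - (z i / z j) ^ K = (z j ^ K - z i ^ K) / z j ^ K"
          by (simp add: field_simps power_divide)
        then show ?thesis by (simp add: norm_divide norm_power z1)
      qed
      finally show ?thesis by (simp add: abs_mult)
    qed
    have "(4 * q) ^ n \<le> (real K / pi) ^ n * ((d / 2) ^ card (\<theta> ` I) * fact (card (\<theta> ` I)))"
      using const by (simp add: card_image[OF inj] I)
    also have "\<dots> \<le> (real K / pi) ^ n * (\<Prod>t\<in>\<theta> ` I. \<bar>t\<bar>)"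
      by (intro mult_left_mono separated_prod_ge) (use I d \<theta>ge \<theta>sep in auto)
    also have "\<dots> = (\<Prod>i\<in>I. real K * \<bar>\<theta> i\<bar> / pi)"
      using I by (simp add: prod.reindex[OF inj] prod_dividef prod.distrib power_divide)
    also have "\<dots> \<le> (\<Prod>i\<in>I. norm (z j ^ K - z i ^ K))"
      by (intro prod_mono) (use factor in auto)
    finally have prod: "(4 * q) ^ n \<le> norm (\<Prod>i\<in>I. z j ^ K - z i ^ K)" by (simp add: prod_norm)
    define M where "M = N - K * n"
    have single: "(\<Sum>l\<le>n. c l * (\<Prod>i\<in>I. z l ^ K - z i ^ K) * z l ^ k) =
        c j * (\<Prod>i\<in>I. z j ^ K - z i ^ K) * z j ^ k" for k
    proof -
      have "(\<Prod>i\<in>I. z l ^ K - z i ^ K) = 0" if "l \<le> n" "l \<noteq> j" for l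
        using I that by (intro prod_zero bexI[of _ l]) (auto simp: I_def)
      then have "(\<Sum>l\<le>n. c l * (\<Prod>i\<in>I. z l ^ K - z i ^ K) * z l ^ k) =
        (\<Sum>l\<in>{j}. c l * (\<Prod>i\<in>I. z l ^ K - z i ^ K) * z l ^ k)"
        using j by (intro sum.mono_neutral_right) auto
      then show ?thesis by simp
    qed
    have "(4 * q) ^ (2 * n) = ((4 * q)\<^sup>2) ^ n" by (rule power_mult)
    also have "(4 * q)\<^sup>2 = 4 * (4 * q\<^sup>2)" by (simp add: power2_eq_square)
    finally have "4 ^ n * (4 * q\<^sup>2) ^ n = (4 * q) ^ (2 * n)"
      by (simp only: power_mult_distrib)
    then have eq: "4 ^ n * ((real N / 2) * (4 * q\<^sup>2) ^ n * (norm (c j))\<^sup>2) =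
        real N / 2 * (4 * q) ^ (2 * n) * (norm (c j))\<^sup>2"
      by (metis mult.assoc mult.commute)
    have "real N / 2 * (4 * q) ^ (2 * n) * (norm (c j))\<^sup>2
        \<le> real (M + 1) * (norm (\<Prod>i\<in>I. z j ^ K - z i ^ K))\<^sup>2 * (norm (c j))\<^sup>2"
    proof (intro mult_mono)
      have "N \<le> 2 * (M + 1)" using Kn by (simp add: M_def)
      then have "real N \<le> real (2 * (M + 1))" by (simp only: of_nat_le_iff)
      then show "real N / 2 \<le> real (M + 1)" by simp
      have "((4 * q) ^ n)\<^sup>2 \<le> (norm (\<Prod>i\<in>I. z j ^ K - z i ^ K))\<^sup>2"
        using prod q0 by (intro power_mono) auto
      then show "(4 * q) ^ (2 * n) \<le> (norm (\<Prod>i\<in>I. z j ^ K - z i ^ K))\<^sup>2"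
        by (simp only: power_even_eq)
    qed (use q0 in auto)
    also have "\<dots> = (\<Sum>k\<le>M. (norm (\<Sum>l\<le>n. c l * (\<Prod>i\<in>I. z l ^ K - z i ^ K) * z l ^ k))\<^sup>2)"
      by (simp add: single norm_mult norm_power z1 power_mult_distrib)
    also have "\<dots> \<le> 4 ^ n * F"
      using exponential_sum_energy_ge[where J = "{..n}" and I = I and z = z and M = M and c = c and K = K] I z1 Kn
      by (simp add: F_def M_def)
    finally have "4 ^ n * ((real N / 2) * (4 * q\<^sup>2) ^ n * (norm (c j))\<^sup>2) \<le> 4 ^ n * F"
      by (simp only: eq)
    then show ?thesis by simp
  qed
  have n4: "real (n + 1) \<le> 4 ^ n"
  proof (induction n)
    case (Suc n) then show ?case by simp
  qed auto
  have "((1/2) * sqrt (real N) * q ^ n)\<^sup>2 * (\<Sum>j\<le>n. (norm (c j))\<^sup>2)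
      = (real N / 4) * q ^ (2 * n) * (\<Sum>j\<le>n. (norm (c j))\<^sup>2)"
    by (simp add: power_mult_distrib power_divide power_mult[symmetric] mult.commute)
  also have "\<dots> \<le> (real N / 2) * q ^ (2 * n) * (\<Sum>j\<le>n. (norm (c j))\<^sup>2)"
    using q0 by (intro mult_right_mono) (auto intro!: sum_nonneg)
  finally have "real (n + 1) * (((1/2) * sqrt (real N) * q ^ n)\<^sup>2 * (\<Sum>j\<le>n. (norm (c j))\<^sup>2))
      \<le> 4 ^ n * ((real N / 2) * q ^ (2 * n) * (\<Sum>j\<le>n. (norm (c j))\<^sup>2))"
    by (rule mult_mono[OF n4]) (auto intro!: sum_nonneg mult_nonneg_nonneg)
  also have "\<dots> = (\<Sum>j\<le>n. (real N / 2) * (4 * q\<^sup>2) ^ n * (norm (c j))\<^sup>2)"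
    by (simp add: sum_distrib_left power_mult_distrib algebra_simps flip: power_mult)
  also have "\<dots> \<le> (\<Sum>j\<le>n. F)" by (intro sum_mono node) auto
  also have "\<dots> = real (n + 1) * F" by simp
  finally have "((1/2) * sqrt (real N) * q ^ n)\<^sup>2 * (\<Sum>j\<le>n. (norm (c j))\<^sup>2) \<le> F"
    by (subst (asm) mult_le_cancel_left_pos) auto
  then show ?thesis by (simp only: q_def F_def z_def)
qed

section \<open>Diagonalization of Gram matrices\<close>

text \<open>
  Fill up with zero rows: a square matrix with a zero row is singular.
\<close>
lemma underdetermined_system_nontrivial_solution:
  fixes ws :: "'a :: field vec list"
  assumes ws: "set ws \<subseteq> carrier_vec n" and len: "length ws < n"
  shows "\<exists>v \<in> carrier_vec n. v \<noteq> 0\<^sub>v n \<and> (\<forall>w\<in>set ws. w \<bullet> v = 0)"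
proof -
  define r where "r i = (if i < length ws then ws ! i else 0\<^sub>v n)" for i
  define B where "B = mat\<^sub>r n n (\<lambda>i. if i = n - 1 then 0\<^sub>v n else r i)"
  have r: "r i \<in> carrier_vec n" for i using ws by (auto simp: r_def)
  have B: "B \<in> carrier_mat n n" by (simp add: B_def)
  have "det B = 0"
    unfolding B_def by (rule det_row_0) (use len r in auto)
  then obtain v where v: "v \<in> carrier_vec n" "v \<noteq> 0\<^sub>v n" "B *\<^sub>v v = 0\<^sub>v n"
    using det_0_iff_vec_prod_zero_field[OF B] by blast
  have "w \<bullet> v = 0" if w: "w \<in> set ws" for w
  proof -
    obtain i where i: "i < length ws" "w = ws ! i" using w by (metis in_set_conv_nth)
    have "row B i = w"
      unfolding B_def using i len r[of i] by (subst row_mat_of_row_fun) (auto simp: r_def)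
    moreover have "(B *\<^sub>v v) $ i = 0" using v(3) i len by simp
    ultimately show ?thesis using i len B by auto
  qed
  then show ?thesis using v by blast
qed

lemma mult_mat_unit_vec:
  fixes A :: "'a :: semiring_1 mat"
  assumes "A \<in> carrier_mat n k" "j < k"
  shows "A *\<^sub>v unit_vec k j = col A j"
proof (rule eq_vecI)
  fix i assume "i < dim_vec (col A j)"
  then have i: "i < n" using assms by simp
  have "(A *\<^sub>v unit_vec k j) $ i = (\<Sum>l\<in>{0..<k}. A $$ (i, l) * (if l = j then 1 else 0))"
    using assms i by (simp add: scalar_prod_def)
  then show "(A *\<^sub>v unit_vec k j) $ i = col A j $ i"
    using assms i by (simp add: if_distrib[of "\<lambda>x. _ * x"] cong: if_cong)
qed (use assms in auto)

lemma index_mat_adjoint: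
  fixes A :: "complex mat"
  assumes "i < dim_col A" "k < dim_row A"
  shows "mat_adjoint A $$ (i, k) = cnj (A $$ (k, i))"
  using assms unfolding mat_adjoint_def by (simp add: mat_of_rows_index)

lemma mat_adjoint_carrier: "A \<in> carrier_mat r n \<Longrightarrow> mat_adjoint (A :: complex mat) \<in> carrier_mat n r"
  by (auto simp: mat_adjoint_def)

text \<open>
  Both the self-adjointness of the Gram matrix and the interpretation of its quadratic form as a squared
  norm are instances of this identity.
\<close>
lemma gram_sesquilinear:
  fixes A :: "complex mat"
  assumes A: "A \<in> carrier_mat r n" and v: "v \<in> carrier_vec n" and w: "w \<in> carrier_vec n"
  shows "(mat_adjoint A * A *\<^sub>v v) \<bullet>c w = (A *\<^sub>v v) \<bullet>c (A *\<^sub>v w)"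
proof -
  define u where "u = A *\<^sub>v v"
  have u: "u \<in> carrier_vec r" using A v by (simp add: u_def)
  have "mat_adjoint A * A *\<^sub>v v = mat_adjoint A *\<^sub>v u"
    unfolding u_def by (rule assoc_mult_mat_vec[OF mat_adjoint_carrier[OF A] A v])
  moreover have "(mat_adjoint A *\<^sub>v u) \<bullet>c w = u \<bullet>c (A *\<^sub>v w)"
  proof -
    have "(mat_adjoint A *\<^sub>v u) \<bullet>c w = (\<Sum>i<n. (\<Sum>k<r. cnj (A $$ (k, i)) * u $ k) * cnj (w $ i))"
      using mat_adjoint_carrier[OF A] A u w
      by (auto simp: scalar_prod_def index_mat_adjoint atLeast0LessThan intro!: sum.cong)
    also have "\<dots> = (\<Sum>k<r. u $ k * (\<Sum>i<n. cnj (A $$ (k, i)) * cnj (w $ i)))"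
      unfolding sum_distrib_left sum_distrib_right
      by (subst sum.swap) (simp add: algebra_simps)
    also have "\<dots> = u \<bullet>c (A *\<^sub>v w)"
      using A u w by (auto simp: scalar_prod_def atLeast0LessThan intro!: sum.cong)
    finally show ?thesis .
  qed
  ultimately show ?thesis by (simp add: u_def)
qed

lemma cscalar_prod_commute:
  fixes v w :: "complex vec"
  assumes "v \<in> carrier_vec n" "w \<in> carrier_vec n"
  shows "v \<bullet>c w = cnj (w \<bullet>c v)"
  using assms by (simp add: scalar_prod_def mult.commute)

lemma cscalar_prod_self:
  fixes v :: "complex vec"
  assumes "v \<in> carrier_vec n"
  shows "v \<bullet>c v = of_real (\<Sum>i<n. (norm (v $ i))\<^sup>2)"
  unfolding scalar_prod_def of_real_sum complex_norm_square
  using assms by (simp add: atLeast0LessThan)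

lemma gram_hermitian:
  fixes A :: "complex mat"
  assumes A: "A \<in> carrier_mat r n" and v: "v \<in> carrier_vec n" and w: "w \<in> carrier_vec n"
  shows "(mat_adjoint A * A *\<^sub>v v) \<bullet>c w = v \<bullet>c (mat_adjoint A * A *\<^sub>v w)"
proof -
  have "mat_adjoint A * A \<in> carrier_mat n n" using A mat_adjoint_carrier[OF A] by simp
  then have "v \<bullet>c (mat_adjoint A * A *\<^sub>v w) = cnj ((mat_adjoint A * A *\<^sub>v w) \<bullet>c v)"
    using v w by (intro cscalar_prod_commute) auto
  also have "\<dots> = cnj ((A *\<^sub>v w) \<bullet>c (A *\<^sub>v v))" by (simp only: gram_sesquilinear[OF A w v])
  also have "\<dots> = (A *\<^sub>v v) \<bullet>c (A *\<^sub>v w)"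
    using A v w by (intro cscalar_prod_commute[of _ r, symmetric]) auto
  finally show ?thesis by (simp only: gram_sesquilinear[OF A v w])
qed

lemma gram_eigenvalue_real:
  fixes A :: "complex mat"
  assumes A: "A \<in> carrier_mat r n" and v: "v \<in> carrier_vec n" "v \<noteq> 0\<^sub>v n"
    and ev: "mat_adjoint A * A *\<^sub>v v = e \<cdot>\<^sub>v v"
  shows "cnj e = e"
proof -
  have "e * (v \<bullet>c v) = cnj e * (v \<bullet>c v)"
    using gram_hermitian[OF A v(1) v(1)] v(1) unfolding ev
    by (auto simp: scalar_prod_def sum_distrib_left algebra_simps)
  moreover have "v \<bullet>c v \<noteq> 0" using v by simp
  ultimately show ?thesis by simp
qed

text \<open>
  A nonzero entry above the diagonal lies inside a block, hence next to the diagonal, and the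
  diagonal is constant along a block.
\<close>
lemma jordan_matrix_off_diagonal:
  fixes n_as :: "(nat \<times> 'a :: zero_neq_one) list"
  assumes "i < j" "j < sum_list (map fst n_as)" "jordan_matrix n_as $$ (i, j) \<noteq> 0"
  shows "j = Suc i \<and> jordan_matrix n_as $$ (i, j) = 1 \<and>
    jordan_matrix n_as $$ (i, i) = jordan_matrix n_as $$ (j, j)"
  using assms
proof (induction n_as arbitrary: i j)
  case (Cons na n_as)
  obtain k a where na: "na = (k, a)" by force
  show ?case
  proof (cases "k \<le> i")
    case True
    then show ?thesis
      using Cons.IH[of "i - k" "j - k"] Cons.prems unfolding na jordan_matrix_Cons
      by (auto simp: less_diff_conv2)
  next
    case False
    then show ?thesis
      using Cons.prems unfolding na jordan_matrix_Cons by (auto split: if_splits)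
  qed
qed auto

text \<open>
  A Jordan chain of length two is impossible for a self-adjoint matrix: from $M p = e p$ and
  $M q = e q + p$ one gets $e \langle q, p\rangle + \langle p, p\rangle = \langle M q, p\rangle =
  \langle q, M p\rangle = e \langle q, p\rangle$ with $e$ real, so $p = 0$. Hence the Jordan form is diagonal.
\<close>
lemma gram_diagonalizable:
  fixes A :: "complex mat"
  assumes A: "A \<in> carrier_mat r n"
  shows "\<exists>D P Q. similar_mat_wit (mat_adjoint A * A) D P Q \<and> diagonal_mat D"
proof -
  define M where "M = mat_adjoint A * A"
  have M: "M \<in> carrier_mat n n" using A mat_adjoint_carrier[OF A] by (simp add: M_def)
  obtain es where "char_poly M = (\<Prod>e\<leftarrow>es. [:- e, 1:])"
    using char_poly_factorized[OF M] by blast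
  then obtain n_as where "jordan_nf M n_as" using jordan_nf_exists[OF M] by blast
  then obtain P Q where wit: "similar_mat_wit M (jordan_matrix n_as) P Q"
    by (auto simp: jordan_nf_def similar_mat_def)
  define J where "J = jordan_matrix n_as"
  note w = similar_mat_witD2[OF M wit[folded J_def]]
  have n: "sum_list (map fst n_as) = n" using w(5) by (auto simp: J_def)
  have MP: "M * P = P * J"
  proof -
    have "M * P = P * J * (Q * P)" using w by (simp add: assoc_mult_mat[of _ n n _ n _ n])
    then show ?thesis using w by simp
  qed
  have colP: "M *\<^sub>v col P j = P *\<^sub>v col J j" if "j < n" for j
    using that w MP col_mult2[of M n n P n j] col_mult2[of P n n J n j] by simp
  have colP0: "col P j \<noteq> 0\<^sub>v n" if j: "j < n" for j
  proof
    assume "col P j = 0\<^sub>v n"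
    then have "col (Q * P) j = 0\<^sub>v n"
      using w j col_mult2[of Q n n P n j] by (auto intro!: eq_vecI simp: scalar_prod_def)
    moreover have "col (Q * P) j $ j = 1" using w j by simp
    ultimately show False using j by simp
  qed
  have upper: "J $$ (k, j) = 0" if "j < k" "k < n" for j k
    unfolding J_def by (rule jordan_matrix_upper_triangular) (use that n in auto)
  have "diagonal_mat J"
  proof (rule ccontr)
    assume "\<not> diagonal_mat J"
    then obtain i' j' where ij': "i' < n" "j' < n" "i' \<noteq> j'" "J $$ (i', j') \<noteq> 0"
      using w(5) by (auto simp: diagonal_mat_def)
    then have "i' < j'" using upper[of j' i'] by (cases "i' < j'") auto
    then have ex: "Suc i' < n \<and> J $$ (i', Suc i') \<noteq> 0"
      using jordan_matrix_off_diagonal[of i' j' n_as] ij' n by (auto simp: J_def)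
    \<comment> \<open>Leftmost, so that column \<open>i\<close> carries nothing above the diagonal and the chain begins there.\<close>
    define i where "i = (LEAST i. Suc i < n \<and> J $$ (i, Suc i) \<noteq> 0)"
    have i: "Suc i < n" "J $$ (i, Suc i) \<noteq> 0"
      using LeastI[of "\<lambda>i. Suc i < n \<and> J $$ (i, Suc i) \<noteq> 0", OF ex] by (auto simp: i_def)
    have least: "J $$ (k, Suc k) = 0" if "k < i" for k
      using not_less_Least[of k "\<lambda>i. Suc i < n \<and> J $$ (i, Suc i) \<noteq> 0"] that i(1) by (auto simp: i_def)
    define e where "e = J $$ (i, i)"
    have one: "J $$ (i, Suc i) = 1" and e: "J $$ (Suc i, Suc i) = e"
      using jordan_matrix_off_diagonal[of i "Suc i" n_as] i n by (auto simp: J_def e_def)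
    have above: "J $$ (k, j) = 0" if "k < j" "j < n" "Suc k \<noteq> j" for k j
      using jordan_matrix_off_diagonal[of k j n_as] that n by (auto simp: J_def)
    define p q where "p = col P i" and "q = col P (Suc i)"
    have pq: "p \<in> carrier_vec n" "q \<in> carrier_vec n" using w(6) i by (auto simp: p_def q_def)
    have "col J i = e \<cdot>\<^sub>v unit_vec n i"
    proof (rule eq_vecI)
      fix k assume "k < dim_vec (e \<cdot>\<^sub>v unit_vec n i)"
      then have k: "k < n" by simp
      consider "k < i" | "k = i" | "i < k" by linarith
      then show "col J i $ k = (e \<cdot>\<^sub>v unit_vec n i) $ k"
        using k i w(5) upper[of i k] above[of k i] least[of k]
        by cases (auto simp: e_def)
    qed (use w(5) in auto)
    then have Mp: "M *\<^sub>v p = e \<cdot>\<^sub>v p"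
      using colP[of i] i w(6) mult_mat_unit_vec[of P n n i] mult_mat_vec[OF w(6), of "unit_vec n i" e]
      by (simp add: p_def)
    have "col J (Suc i) = e \<cdot>\<^sub>v unit_vec n (Suc i) + unit_vec n i"
    proof (rule eq_vecI)
      fix k assume "k < dim_vec (e \<cdot>\<^sub>v unit_vec n (Suc i) + unit_vec n i)"
      then have k: "k < n" by simp
      consider "k < i" | "k = i" | "k = Suc i" | "Suc i < k" by linarith
      then show "col J (Suc i) $ k = (e \<cdot>\<^sub>v unit_vec n (Suc i) + unit_vec n i) $ k"
        using k i w(5) upper[of "Suc i" k] above[of k "Suc i"] one e
        by cases auto
    qed (use w(5) in auto)
    then have Mq: "M *\<^sub>v q = e \<cdot>\<^sub>v q + p"
      using colP[of "Suc i"] i w(6) mult_mat_unit_vec[of P n n i] mult_mat_unit_vec[of P n n "Suc i"]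
        mult_mat_vec[OF w(6), of "unit_vec n (Suc i)" e]
        mult_add_distrib_mat_vec[OF w(6), of "e \<cdot>\<^sub>v unit_vec n (Suc i)" "unit_vec n i"]
      by (simp add: p_def q_def)
    have "cnj e = e"
      using gram_eigenvalue_real[OF A pq(1)] Mp colP0[of i] i by (simp add: M_def p_def)
    have "e * (q \<bullet>c p) + p \<bullet>c p = (M *\<^sub>v q) \<bullet>c p"
      unfolding Mq using pq by (simp add: add_scalar_prod_distrib[of _ n])
    also have "\<dots> = q \<bullet>c (M *\<^sub>v p)"
      unfolding M_def by (rule gram_hermitian[OF A pq(2,1)])
    also have "\<dots> = e * (q \<bullet>c p)"
      unfolding Mp using pq \<open>cnj e = e\<close>
      by (auto simp: scalar_prod_def sum_distrib_left algebra_simps)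
    finally have "p \<bullet>c p = 0" by simp
    then show False using pq(1) colP0[of i] i by (simp add: p_def)
  qed
  then show ?thesis using wit unfolding M_def J_def by blast
qed

section \<open>Singular values and the quadratic form of a subspace\<close>

lemma proots_prod_linear_factors:
  fixes es :: "'a :: idom list"
  shows "proots (\<Prod>e\<leftarrow>es. [:- e, 1:]) = mset es"
proof (induction es)
  case (Cons e es)
  have "(\<Prod>e\<leftarrow>es. [:- e, 1:]) \<noteq> 0" by (auto simp: prod_list_zero_iff)
  then have "proots ([:- e, 1:] * (\<Prod>e\<leftarrow>es. [:- e, 1:])) = add_mset e (mset es)"
    by (subst proots_mult) (auto simp: Cons.IH)
  then show ?case by simp
qed auto

lemma length_filter_less_ge:
  fixes L :: "'a :: linorder list"
  assumes "sorted (rev L)" "m < length L" "L ! m < t"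
  shows "length L - m \<le> length (filter (\<lambda>x. x < t) L)"
proof -
  have "{m..<length L} \<subseteq> {i. i < length L \<and> L ! i < t}"
  proof
    fix i assume "i \<in> {m..<length L}"
    then show "i \<in> {i. i < length L \<and> L ! i < t}"
      using sorted_rev_nth_mono[OF assms(1), of m i] assms(3) by auto
  qed
  then have "card {m..<length L} \<le> card {i. i < length L \<and> L ! i < t}"
    by (intro card_mono) auto
  then show ?thesis by (simp add: length_filter_conv_card)
qed

lemma cscalar_prod_mult_mat_vec:
  fixes P :: "complex mat"
  assumes P: "P \<in> carrier_mat n k" and a: "a \<in> carrier_vec k" and b: "b \<in> carrier_vec k"
  shows "(P *\<^sub>v a) \<bullet>c (P *\<^sub>v b) = (\<Sum>r<k. \<Sum>s<k. a $ r * cnj (b $ s) * (col P r \<bullet>c col P s))"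
proof -
  have "(P *\<^sub>v a) \<bullet>c (P *\<^sub>v b) =
      (\<Sum>i<n. (\<Sum>r<k. P $$ (i, r) * a $ r) * (\<Sum>s<k. cnj (P $$ (i, s)) * cnj (b $ s)))"
    using assms by (auto simp: scalar_prod_def atLeast0LessThan intro!: sum.cong)
  also have "\<dots> = (\<Sum>i<n. \<Sum>r<k. \<Sum>s<k. a $ r * cnj (b $ s) * (P $$ (i, r) * cnj (P $$ (i, s))))"
    unfolding sum_product by (intro sum.cong) (auto simp: algebra_simps)
  also have "\<dots> = (\<Sum>r<k. \<Sum>s<k. \<Sum>i<n. a $ r * cnj (b $ s) * (P $$ (i, r) * cnj (P $$ (i, s))))"
    by (subst sum.swap, rule sum.cong[OF refl], rule sum.swap)
  also have "\<dots> = (\<Sum>r<k. \<Sum>s<k. a $ r * cnj (b $ s) * (col P r \<bullet>c col P s))"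
    using P by (auto simp: scalar_prod_def sum_distrib_left atLeast0LessThan intro!: sum.cong)
  finally show ?thesis .
qed

text \<open>
  This is the half of the Courant--Fischer principle in which a lower bound for the quadratic form on
  one subspace of dimension $m$, here the vectors supported on the first $m$ coordinates, bounds the
  $m$-th singular value.
  
  Suppose the $m$-th singular value is below $t$. Then at least $n-m+1$ of the eigenvalues $d_i$ of the Gram
  matrix are below $t^2$, and by counting dimensions some nonzero $c$ in the span of their eigenvectors
  $p_i$ lies in the subspace. The eigenvectors need not be orthogonal inside an eigenspace, but
  $\langle p_i, p_j\rangle = 0$ whenever $d_i \ne d_j$. Write $c = \sum_i a_i p_i$ and put
  $y = \sum_i \sqrt{t^2 - d_i}\, a_i p_i$. Because only pairs with $d_i = d_j$ contribute,
  $\|y\|^2 = t^2 \|c\|^2 - \|A c\|^2$, and this is positive since $y \ne 0$: a contradiction.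
\<close>
lemma singular_value_ge:
  fixes A :: "complex mat"
  assumes A: "A \<in> carrier_mat r n" and m: "1 \<le> m" "m \<le> n" and t: "0 \<le> t"
    and bound: "\<And>c. c \<in> carrier_vec n \<Longrightarrow> (\<And>i. m \<le> i \<Longrightarrow> i < n \<Longrightarrow> c $ i = 0) \<Longrightarrow>
      t\<^sup>2 * (\<Sum>i<n. (norm (c $ i))\<^sup>2) \<le> (\<Sum>k<r. (norm ((A *\<^sub>v c) $ k))\<^sup>2)"
  shows "t \<le> singular_value m A"
proof (rule ccontr)
  assume "\<not> t \<le> singular_value m A"
  then have less: "singular_values A ! (m - 1) < t" by (simp add: singular_value_def)
  define M where "M = mat_adjoint A * A"
  have M: "M \<in> carrier_mat n n" using A mat_adjoint_carrier[OF A] by (simp add: M_def)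
  obtain D P Q where wit: "similar_mat_wit M D P Q" and "diagonal_mat D"
    using gram_diagonalizable[OF A] unfolding M_def by blast
  note w = similar_mat_witD2[OF M wit]
  define d where "d i = D $$ (i, i)" for i
  define p where "p i = col P i" for i
  have D0: "D $$ (i, j) = (if i = j then d i else 0)" if "i < n" "j < n" for i j
    using that \<open>diagonal_mat D\<close> w(5) by (auto simp: diagonal_mat_def d_def)
  have p: "p i \<in> carrier_vec n" if "i < n" for i using that w(6) by (simp add: p_def)
  have MP: "M * P = P * D"
  proof -
    have "M * P = P * D * (Q * P)" using w by (simp add: assoc_mult_mat[of _ n n _ n _ n])
    then show ?thesis using w by simp
  qed
  have QPv: "Q *\<^sub>v (P *\<^sub>v v) = v" if "v \<in> carrier_vec n" for v
    using that w assoc_mult_mat_vec[OF w(7) w(6), of v] by simp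
  have Mp: "M *\<^sub>v p j = d j \<cdot>\<^sub>v p j" if j: "j < n" for j
  proof -
    have "col D j = d j \<cdot>\<^sub>v unit_vec n j"
      using j w(5) D0 by (intro eq_vecI) auto
    then show ?thesis
      using j w MP col_mult2[of M n n P n j] col_mult2[of P n n D n j]
        mult_mat_unit_vec[of P n n j] mult_mat_vec[OF w(6), of "unit_vec n j" "d j"]
      by (simp add: p_def)
  qed
  have p0: "p j \<noteq> 0\<^sub>v n" if j: "j < n" for j
  proof
    assume "p j = 0\<^sub>v n"
    then have "unit_vec n j = Q *\<^sub>v 0\<^sub>v n"
      using QPv[of "unit_vec n j"] mult_mat_unit_vec[of P n n j] j w(6) by (simp add: p_def)
    then have "unit_vec n j $ j = (0 :: complex)" using w(7) j by simp
    then show False using j by simp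
  qed
  have real: "cnj (d j) = d j" if "j < n" for j
    using gram_eigenvalue_real[OF A p p0] Mp that unfolding M_def by blast
  have orth: "p i \<bullet>c p j = 0" if "i < n" "j < n" "d i \<noteq> d j" for i j
  proof -
    have "d i * (p i \<bullet>c p j) = d j * (p i \<bullet>c p j)"
      using gram_hermitian[OF A p p, of i j] that Mp[of i] Mp[of j] p[of i] p[of j] real[of j]
      unfolding M_def[symmetric]
      by (auto simp: scalar_prod_def sum_distrib_left algebra_simps)
    then show ?thesis using that by simp
  qed
  define f :: "complex \<Rightarrow> real" where "f z = sqrt (Re z)" for z
  define ds where "ds = diag_mat D"
  have ds: "length ds = n" "\<And>i. i < n \<Longrightarrow> ds ! i = d i"
    using w(5) by (auto simp: ds_def diag_mat_def d_def)
  have "char_poly M = char_poly D"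
    using wit by (intro char_poly_similar) (auto simp: similar_mat_def)
  also have "\<dots> = (\<Prod>e\<leftarrow>ds. [:- e, 1:])"
    unfolding ds_def using w(5) D0 by (intro char_poly_upper_triangular[of _ n]) auto
  finally have sv: "singular_values A = rev (sort (map f ds))"
    unfolding singular_values_def M_def[symmetric]
    by (simp add: proots_prod_linear_factors f_def[abs_def] sorted_list_of_multiset_mset flip: mset_map)
  define S where "S = {i. i < n \<and> Re (d i) < t\<^sup>2}"
  have S: "finite S" "S \<subseteq> {..<n}" by (auto simp: S_def)
  have cardS: "n - (m - 1) \<le> card S"
  proof -
    let ?L = "rev (sort (map f ds))"
    have "n - (m - 1) \<le> length (filter (\<lambda>x. x < t) ?L)"
      using length_filter_less_ge[of ?L "m - 1" t] less m ds by (simp add: sv)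
    also have "\<dots> = length (filter (\<lambda>x. x < t) (map f ds))"
      by (metis mset_filter mset_rev mset_sort size_mset)
    also have "\<dots> = card {i. i < n \<and> f (d i) < t}"
      using ds by (auto simp: length_filter_conv_card intro!: arg_cong[of _ _ card])
    also have "\<dots> \<le> card S"
    proof (intro card_mono subsetI)
      fix i assume i: "i \<in> {i. i < n \<and> f (d i) < t}"
      have "Re (d i) < t\<^sup>2"
      proof (rule ccontr)
        assume "\<not> Re (d i) < t\<^sup>2"
        then have "t \<le> sqrt (Re (d i))" by (intro real_le_rsqrt) auto
        then show False using i by (simp add: f_def)
      qed
      then show "i \<in> S" using i by (simp add: S_def)
    qed (use S in auto)
    finally show ?thesis .
  qed
  \<comment> \<open>The first block of equations confines \<open>a\<close> to the small eigenvalues,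
    the second one forces \<open>P *\<^sub>v a\<close> to be supported on the first \<open>m\<close> coordinates.\<close>
  define ws where "ws = map (unit_vec n) (filter (\<lambda>i. i \<notin> S) [0..<n]) @ map (row P) [m..<n]"
  have "length (filter (\<lambda>i. i \<notin> S) [0..<n]) = card ({..<n} - S)"
    by (subst distinct_card[symmetric]) (auto intro!: arg_cong[of _ _ card])
  also have "\<dots> = n - card S" using S by (simp add: card_Diff_subset)
  finally have len: "length ws < n"
    using cardS m card_mono[OF _ S(2)] by (simp add: ws_def)
  have "set ws \<subseteq> carrier_vec n" using w(6) by (auto simp: ws_def)
  from underdetermined_system_nontrivial_solution[OF this len]
  obtain a where a: "a \<in> carrier_vec n" "a \<noteq> 0\<^sub>v n" "\<And>v. v \<in> set ws \<Longrightarrow> v \<bullet> a = 0" by blast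
  have a0: "a $ i = 0" if "i < n" "i \<notin> S" for i
    using a(3)[of "unit_vec n i"] a(1) that by (auto simp: ws_def)
  define c where "c = P *\<^sub>v a"
  have c: "c \<in> carrier_vec n" using w(6) a by (simp add: c_def)
  have c0: "c $ i = 0" if "m \<le> i" "i < n" for i
    using a(3)[of "row P i"] that w(6) by (simp add: ws_def c_def)
  define b where "b = vec n (\<lambda>i. of_real (sqrt (t\<^sup>2 - Re (d i))) * a $ i)"
  define y where "y = P *\<^sub>v b"
  have b: "b \<in> carrier_vec n" by (simp add: b_def)
  have y: "y \<in> carrier_vec n" using w(6) b by (simp add: y_def)
  have "y \<noteq> 0\<^sub>v n"
  proof
    assume "y = 0\<^sub>v n"
    moreover have "Q *\<^sub>v 0\<^sub>v n = 0\<^sub>v n" using w(7) by (intro eq_vecI) auto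
    ultimately have "b = 0\<^sub>v n" using QPv[OF b] by (simp add: y_def)
    have "a $ i = 0" if i: "i < n" for i
    proof (cases "i \<in> S")
      case True
      have "b $ i = 0" using \<open>b = 0\<^sub>v n\<close> i by simp
      then show ?thesis using True i by (auto simp: b_def S_def)
    qed (use a0 i in auto)
    then show False using a(1,2) by (auto intro!: eq_vecI)
  qed
  then have y_pos: "(\<Sum>i<n. (norm (y $ i))\<^sup>2) > 0"
  proof -
    have "y \<bullet>c y \<noteq> 0" using y \<open>y \<noteq> 0\<^sub>v n\<close> by simp
    then have "(\<Sum>i<n. (norm (y $ i))\<^sup>2) \<noteq> 0"
      by (simp only: cscalar_prod_self[OF y] of_real_eq_0_iff not_False_eq_True)
    moreover have "(\<Sum>i<n. (norm (y $ i))\<^sup>2) \<ge> 0" by (intro sum_nonneg) auto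
    ultimately show ?thesis by linarith
  qed
  have Ac: "(A *\<^sub>v c) \<bullet>c (A *\<^sub>v c) = (\<Sum>i<n. \<Sum>j<n. d i * a $ i * cnj (a $ j) * (p i \<bullet>c p j))"
  proof -
    have "M *\<^sub>v c = P *\<^sub>v (D *\<^sub>v a)"
      unfolding c_def using w MP a(1) assoc_mult_mat_vec[OF M w(6) a(1)]
        assoc_mult_mat_vec[OF w(6) w(5) a(1)] by simp
    moreover have "(D *\<^sub>v a) $ i = d i * a $ i" if "i < n" for i
    proof -
      have "(D *\<^sub>v a) $ i = (\<Sum>j<n. (if i = j then d i else 0) * a $ j)"
        using that w(5) a(1) D0 by (simp add: scalar_prod_def atLeast0LessThan)
      then show ?thesis using that by (simp add: if_distrib[of "\<lambda>x. x * _"] cong: if_cong)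
    qed
    moreover have "D *\<^sub>v a \<in> carrier_vec n" using w(5) a(1) by simp
    ultimately have "(M *\<^sub>v c) \<bullet>c c = (\<Sum>i<n. \<Sum>j<n. d i * a $ i * cnj (a $ j) * (p i \<bullet>c p j))"
      using cscalar_prod_mult_mat_vec[OF w(6), of "D *\<^sub>v a" a] a(1) by (simp add: c_def p_def)
    then show ?thesis using gram_sesquilinear[OF A c c] by (simp add: M_def)
  qed
  have yy: "y \<bullet>c y = (\<Sum>i<n. \<Sum>j<n. (of_real (t\<^sup>2) - d i) * a $ i * cnj (a $ j) * (p i \<bullet>c p j))"
    unfolding y_def cscalar_prod_mult_mat_vec[OF w(6) b b] p_def[symmetric]
  proof (intro sum.cong refl)
    fix i j assume "i \<in> {..<n}" "j \<in> {..<n}"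
    then have ij: "i < n" "j < n" by auto
    show "b $ i * cnj (b $ j) * (p i \<bullet>c p j) =
      (of_real (t\<^sup>2) - d i) * a $ i * cnj (a $ j) * (p i \<bullet>c p j)"
    proof (cases "d i = d j \<and> i \<in> S")
      case True
      then have "t\<^sup>2 - Re (d i) \<ge> 0" by (auto simp: S_def)
      then have "complex_of_real (sqrt (t\<^sup>2 - Re (d i))) * complex_of_real (sqrt (t\<^sup>2 - Re (d i)))
          = of_real (t\<^sup>2 - Re (d i))"
        by (simp only: of_real_mult[symmetric] real_sqrt_mult_self abs_of_nonneg)
      also have "\<dots> = of_real (t\<^sup>2) - d i"
        using real[OF ij(1)] by (simp add: complex_eq_iff)
      finally have "of_real (t\<^sup>2) - d i =
        complex_of_real (sqrt (t\<^sup>2 - Re (d i))) * complex_of_real (sqrt (t\<^sup>2 - Re (d i)))" ..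
      then show ?thesis using ij True unfolding b_def by (simp only: index_vec) (simp add: mult_ac)
    qed (use ij a0 orth in \<open>auto simp: b_def\<close>)
  qed
  have cc: "c \<bullet>c c = (\<Sum>i<n. \<Sum>j<n. a $ i * cnj (a $ j) * (p i \<bullet>c p j))"
    unfolding c_def p_def by (rule cscalar_prod_mult_mat_vec[OF w(6) a(1) a(1)])
  have "of_real (t\<^sup>2) * (c \<bullet>c c) = (A *\<^sub>v c) \<bullet>c (A *\<^sub>v c) + y \<bullet>c y"
    unfolding Ac yy cc sum_distrib_left sum.distrib[symmetric]
    by (intro sum.cong refl) (simp add: algebra_simps)
  moreover have "A *\<^sub>v c \<in> carrier_vec r" using A c by simp
  ultimately have "complex_of_real (t\<^sup>2 * (\<Sum>i<n. (norm (c $ i))\<^sup>2)) =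
      of_real ((\<Sum>k<r. (norm ((A *\<^sub>v c) $ k))\<^sup>2) + (\<Sum>i<n. (norm (y $ i))\<^sup>2))"
    using cscalar_prod_self[OF c] cscalar_prod_self[OF y] cscalar_prod_self[of "A *\<^sub>v c" r]
    by (simp only: of_real_add of_real_mult)
  then have "t\<^sup>2 * (\<Sum>i<n. (norm (c $ i))\<^sup>2) =
      (\<Sum>k<r. (norm ((A *\<^sub>v c) $ k))\<^sup>2) + (\<Sum>i<n. (norm (y $ i))\<^sup>2)"
    by (simp only: of_real_eq_iff)
  then show False using bound[OF c c0] y_pos by linarith
qed

section \<open>Clustered nodes\<close>

text \<open>
  The first \<^term>\<open>m\<close> columns form the Vandermonde matrix of \<^term>\<open>m\<close> of the nodes, which inherit the
  separation and the diameter of the cluster.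
\<close>
theorem theorem7p1:
  shows "\<exists>(C1 :: nat \<Rightarrow> real) (C3 :: real).
    (\<forall>l \<ge> 1. C1 l > 0) \<and> C3 > 0 \<and>
    (\<forall>(l :: nat) (xs :: real list) (\<Delta> :: real) (\<tau> :: real) (N :: nat).
       l \<ge> 1 \<longrightarrow> distinct xs \<longrightarrow> clustered \<Delta> l \<tau> (set xs) \<longrightarrow>
       l - 1 \<le> N \<longrightarrow> C1 l \<le> real N \<longrightarrow>
       (\<tau> \<noteq> 0 \<longrightarrow> real N \<le> 2 * pi / (\<tau> * \<Delta>)) \<longrightarrow>
       (\<forall>m \<in> {1..l}.
          singular_value m (vandermonde N xs)
            \<ge> C3 * sqrt (real N) * (real N * \<Delta> / (32 * pi * exp 1)) ^ (m - 1)))"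
proof -
  have main: "(1/2) * sqrt (real N) * (real N * \<Delta> / (32 * pi * exp 1)) ^ (m - 1)
      \<le> singular_value m (vandermonde N xs)"
    if "distinct xs" and cl: "clustered \<Delta> l \<tau> (set xs)" and N: "2 * real l \<le> real N"
      and \<tau>N: "\<tau> \<noteq> 0 \<longrightarrow> real N \<le> 2 * pi / (\<tau> * \<Delta>)" and m: "m \<in> {1..l}"
    for l :: nat and xs :: "real list" and \<Delta> \<tau> :: real and N m :: nat
  proof -
    have len: "length xs = l" using cl \<open>distinct xs\<close> by (simp add: clustered_def distinct_card)
    have "\<Delta> > 0" using cl by (simp add: clustered_def)
    define n where "n = m - 1"
    have nl: "n < l" and mn: "m = Suc n" using m by (auto simp: n_def)
    have V: "vandermonde N xs \<in> carrier_mat (N + 1) l" by (simp add: vandermonde_def len)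
    have dist: "\<Delta> \<le> wrap_dist (xs ! i) (xs ! j)" "real N * wrap_dist (xs ! i) (xs ! j) \<le> 2 * pi"
      if ij: "i \<le> n" "j \<le> n" "i \<noteq> j" for i j
    proof -
      have "xs ! i \<noteq> xs ! j" "xs ! i \<in> set xs" "xs ! j \<in> set xs"
        using ij nl len \<open>distinct xs\<close> by (auto simp: nth_eq_iff_index_eq)
      then have d: "\<Delta> \<le> wrap_dist (xs ! i) (xs ! j)" "wrap_dist (xs ! i) (xs ! j) \<le> \<tau> * \<Delta>"
        using cl by (auto simp: clustered_def)
      \<comment> \<open>Two distinct indices exist, so the cluster has at least two nodes.\<close>
      have "\<tau> > 0" using cl ij nl by (auto simp: clustered_def)
      then have "real N * (\<tau> * \<Delta>) \<le> 2 * pi" using \<tau>N \<open>\<Delta> > 0\<close> by (simp add: field_simps)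
      moreover have "real N * wrap_dist (xs ! i) (xs ! j) \<le> real N * (\<tau> * \<Delta>)"
        by (rule mult_left_mono[OF d(2)]) simp
      ultimately show "\<Delta> \<le> wrap_dist (xs ! i) (xs ! j)" "real N * wrap_dist (xs ! i) (xs ! j) \<le> 2 * pi"
        using d(1) by linarith+
    qed
    show ?thesis
    proof (rule singular_value_ge[OF V])
      fix c :: "complex vec"
      assume c: "c \<in> carrier_vec l" and c0: "\<And>i. m \<le> i \<Longrightarrow> i < l \<Longrightarrow> c $ i = 0"
      have restrict: "(\<Sum>j<l. g j) = (\<Sum>j\<le>n. g j)"
        if "\<And>j. c $ j = 0 \<Longrightarrow> g j = 0" for g :: "nat \<Rightarrow> 'b :: comm_monoid_add"
        using nl mn by (intro sum.mono_neutral_right) (auto intro!: that c0)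
      have Vc: "(vandermonde N xs *\<^sub>v c) $ k = (\<Sum>j\<le>n. c $ j * exp (\<i> * of_real (xs ! j)) ^ k)"
        if "k < N + 1" for k
      proof -
        have "(vandermonde N xs *\<^sub>v c) $ k = (\<Sum>j<l. exp (\<i> * of_nat k * of_real (xs ! j)) * c $ j)"
          using that c len by (simp add: vandermonde_def scalar_prod_def atLeast0LessThan)
        also have "\<dots> = (\<Sum>j\<le>n. exp (\<i> * of_nat k * of_real (xs ! j)) * c $ j)"
          by (rule restrict) simp
        also have "\<dots> = (\<Sum>j\<le>n. c $ j * exp (\<i> * of_real (xs ! j)) ^ k)"
          by (intro sum.cong) (simp_all add: mult_ac flip: exp_of_nat_mult)
        finally show ?thesis .
      qed
      have "2 * l \<le> N" using N by linarith
      moreover have "2 * (n + 1) \<le> 2 * l" using nl by (intro mult_le_mono2) simp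
      ultimately have "2 * (n + 1) \<le> N" by (rule order_trans[rotated])
      from vandermonde_lower_bound[OF \<open>\<Delta> > 0\<close> this, of "\<lambda>j. xs ! j" "\<lambda>j. c $ j", OF dist]
      show "((1/2) * sqrt (real N) * (real N * \<Delta> / (32 * pi * exp 1)) ^ (m - 1))\<^sup>2 * (\<Sum>i<l. (norm (c $ i))\<^sup>2)
          \<le> (\<Sum>k<N + 1. (norm ((vandermonde N xs *\<^sub>v c) $ k))\<^sup>2)"
        by (simp add: Vc restrict n_def lessThan_Suc_atMost del: sum.lessThan_Suc)
    qed (use m \<open>\<Delta> > 0\<close> in auto)
  qed
  show ?thesis
    by (rule exI[of _ "\<lambda>l. 2 * real l"], rule exI[of _ "1/2"],
        intro conjI allI impI ballI) (simp, simp, rule main, assumption+)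
qed

end
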